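(* Let $F$ be a one-dimensional tropical fan in $\mathbb{R}^n$ whose rays span $\mathbb{R}^n$, with rays $\mathbb{R}_+v_1,\dots,\mathbb{R}_+v_q$. Define a relation $\sim$ on the set of rays of $F$ by: $\mathbb{R}_+v_i\sim\mathbb{R}_+v_j$ if and only if $i=j$ or $\{\mathbb{R}_+v_i,\mathbb{R}_+v_j\}\in\mathrm{Gly}(F)$. Then $\sim$ is an equivalence relation.
   Context: A one-dimensional tropical fan $F$ in $\mathbb{R}^n$ consists of finitely many distinct rays $\mathbb{R}_+v_1,\dots,\mathbb{R}_+v_q$ (and the origin), with $v_i\in\mathbb{Z}^n$ primitive, together with positive integer weights $\omega_1,\dots,\omega_q$ satisfying the balancing condition $\sum_i\omega_iv_i=0$. A tropical binomial is a function $L=\max(l,h)$ on $\mathbb{R}^n$ with $l,h\in(\mathbb{Z}^n)^\vee$; its intersection number with $F$ is $L\cdot F=\sum_{i=1}^q\omega_iL(v_i)$. For a tropical binomial $L$ with $L\cdot F=1$, the gallery of $F$ over $L$ is the set of rays $g(F,L)=\{\mathbb{R}_+v_i: L(v_i)+L(-v_i)=1\}$ (i.e. the rays whose spanned line, with weight $1$, has intersection number $1$ with $L$). $\mathrm{Gly}(F)$ denotes the set of all galleries of $F$. *)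

theory Defs
  imports "HOL-Analysis.Analysis"
begin

definition int_lattice :: "(real ^ 'n) set" where
  "int_lattice = {x. \<forall>i. x $ i \<in> \<int>}"

text \<open>
  The dual lattice of \<open>\<int>^n\<close>, each homomorphism from \<open>\<int>^n\<close> to \<open>\<int>\<close> being identified with its
  unique linear extension to the real space.
\<close>

definition dual_lattice :: "(real ^ 'n \<Rightarrow> real) set" where
  "dual_lattice = {l. linear l \<and> l ` int_lattice \<subseteq> \<int>}"

definition primitive :: "real ^ 'n \<Rightarrow> bool" where
  "primitive v \<longleftrightarrow> v \<in> int_lattice \<and> v \<noteq> 0 \<and>
     (\<forall>k::nat. \<forall>w\<in>int_lattice. v = real k *\<^sub>R w \<longrightarrow> k = 1)"

definition ray :: "real ^ 'n \<Rightarrow> (real ^ 'n) set" where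
  "ray v = {t *\<^sub>R v | t. 0 \<le> t}"

text \<open>
  Only the values of \<open>gen\<close> and \<open>weight\<close> at the indices \<open>1, \<dots>, q\<close>, where \<open>q = num_rays\<close>, are meaningful.
\<close>

record ('n::finite) fan_data =
  num_rays :: nat
  gen :: "nat \<Rightarrow> real ^ 'n"
  weight :: "nat \<Rightarrow> nat"

definition rays :: "('n::finite) fan_data \<Rightarrow> (real ^ 'n) set set" where
  "rays F = (\<lambda>i. ray (gen F i)) ` {1..num_rays F}"

definition tropical_fan :: "('n::finite) fan_data \<Rightarrow> bool" where
  "tropical_fan F \<longleftrightarrow>
     (\<forall>i\<in>{1..num_rays F}. primitive (gen F i) \<and> 0 < weight F i) \<and>
     inj_on (\<lambda>i. ray (gen F i)) {1..num_rays F} \<and>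
     (\<Sum>i=1..num_rays F. real (weight F i) *\<^sub>R gen F i) = 0"

definition tropical_binomial :: "(real ^ 'n \<Rightarrow> real) \<Rightarrow> bool" where
  "tropical_binomial L \<longleftrightarrow>
     (\<exists>l\<in>dual_lattice. \<exists>h\<in>dual_lattice. L = (\<lambda>x. max (l x) (h x)))"

definition intersection_number :: "(real ^ 'n \<Rightarrow> real) \<Rightarrow> ('n::finite) fan_data \<Rightarrow> real" where
  "intersection_number L F = (\<Sum>i=1..num_rays F. real (weight F i) * L (gen F i))"

definition gallery :: "('n::finite) fan_data \<Rightarrow> (real ^ 'n \<Rightarrow> real) \<Rightarrow> (real ^ 'n) set set" where
  "gallery F L = {ray (gen F i) | i. i \<in> {1..num_rays F} \<and> L (gen F i) + L (- gen F i) = 1}"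

definition Gly :: "('n::finite) fan_data \<Rightarrow> (real ^ 'n) set set set" where
  "Gly F = {gallery F L | L. tropical_binomial L \<and> intersection_number L F = 1}"

definition gallery_rel :: "('n::finite) fan_data \<Rightarrow> ((real ^ 'n) set \<times> (real ^ 'n) set) set" where
  "gallery_rel F = {(ray (gen F i), ray (gen F j)) | i j.
     i \<in> {1..num_rays F} \<and> j \<in> {1..num_rays F} \<and>
     (i = j \<or> {ray (gen F i), ray (gen F j)} \<in> Gly F)}"

end

theory Submission
  imports Defs
begin

text \<open>
  For \<open>L = max(l, h)\<close> put \<open>m = h - l\<close>. Then \<open>L(v) + L(-v) = \<bar>m(v)\<bar>\<close>, and balancing turns
  \<open>L \<cdot> F = 1\<close> into \<open>\<Sum> \<omega>\<^sub>k \<bar>m(v\<^sub>k)\<bar> = 2\<close>. So two distinct rays form a gallery iff both have weight 1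
  and some integral form \<open>m\<close> takes the values \<open>1\<close> and \<open>-1\<close> on them and vanishes on all other rays.
  Adding such forms for \<open>(i, j)\<close> and \<open>(j, k)\<close> yields one for \<open>(i, k)\<close>.
\<close>

text \<open>A gallery is unordered, but the signs here orient the pair, so that forms for
  \<open>(i, j)\<close> and \<open>(j, k)\<close> cancel at \<open>gen F j\<close> when
  added.\<close>

definition separating_form :: "('n::finite) fan_data \<Rightarrow> nat \<Rightarrow> nat \<Rightarrow> (real ^ 'n \<Rightarrow> real) \<Rightarrow> bool" where
  "separating_form F i j m \<longleftrightarrow> m \<in> dual_lattice \<and> m (gen F i) = 1 \<and> m (gen F j) = -1 \<and>
     (\<forall>k\<in>{1..num_rays F} - {i, j}. m (gen F k) = 0)"

lemma dual_lattice_add: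
  assumes "l \<in> dual_lattice" "h \<in> dual_lattice"
  shows "(\<lambda>x. l x + h x) \<in> dual_lattice"
  using assms by (auto simp: dual_lattice_def image_subset_iff intro: linear_compose_add)

lemma dual_lattice_minus:
  assumes "l \<in> dual_lattice"
  shows "(\<lambda>x. - l x) \<in> dual_lattice"
  using assms by (auto simp: dual_lattice_def image_subset_iff intro: linear_compose_neg)

lemma dual_lattice_diff:
  assumes "l \<in> dual_lattice" "h \<in> dual_lattice"
  shows "(\<lambda>x. l x - h x) \<in> dual_lattice"
  using dual_lattice_add[OF assms(1) dual_lattice_minus[OF assms(2)]] by simp

lemma dual_lattice_zero: "(\<lambda>x. 0) \<in> dual_lattice"
  by (auto simp: dual_lattice_def intro: linear_zero)

lemma balanced_linear:
  assumes "tropical_fan F" "linear m"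
  shows "(\<Sum>k=1..num_rays F. real (weight F k) * m (gen F k)) = 0"
proof -
  have "(\<Sum>k=1..num_rays F. real (weight F k) * m (gen F k))
      = m (\<Sum>k=1..num_rays F. real (weight F k) *\<^sub>R gen F k)"
    using assms(2) by (simp add: linear_sum linear_scale)
  also have "\<dots> = 0"
    using assms by (simp add: tropical_fan_def linear_0)
  finally show ?thesis .
qed

text \<open>A maximum is half the sum plus half the absolute difference; balancing kills the
  contribution of the linear sum.\<close>

lemma intersection_number_max:
  assumes "tropical_fan F" "linear l" "linear h"
  shows "intersection_number (\<lambda>x. max (l x) (h x)) F
    = (\<Sum>k=1..num_rays F. real (weight F k) * \<bar>h (gen F k) - l (gen F k)\<bar>) / 2"
proof -
  have max: "max a b = (a + b + \<bar>b - a\<bar>) / 2" for a b :: real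
    by (simp add: max_def)
  show ?thesis
    using balanced_linear[OF assms(1,2)] balanced_linear[OF assms(1,3)]
    by (simp add: intersection_number_def max sum.distrib distrib_left
        flip: sum_divide_distrib)
qed

text \<open>The linear part cancels between \<open>v\<close> and \<open>- v\<close>. Distinct
  indices give distinct rays, so membership of a ray is a condition on its own generator.\<close>

lemma ray_mem_gallery_max_iff:
  assumes "tropical_fan F" "linear l" "linear h" "k \<in> {1..num_rays F}"
  shows "ray (gen F k) \<in> gallery F (\<lambda>x. max (l x) (h x))
    \<longleftrightarrow> \<bar>h (gen F k) - l (gen F k)\<bar> = 1"
proof -
  have "max (l v) (h v) + max (l (- v)) (h (- v)) = \<bar>h v - l v\<bar>" for v
    using assms(2,3) by (simp add: linear_neg max_def)
  then show ?thesis
    using assms(1,4) by (auto simp: gallery_def tropical_fan_def dest: inj_onD)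
qed

lemma separating_form_swap:
  assumes "separating_form F i j m"
  shows "separating_form F j i (\<lambda>x. - m x)"
  using assms by (auto simp: separating_form_def dual_lattice_minus)

text \<open>Distinctness of the three indices makes \<open>m'\<close> vanish at
  \<open>gen F i\<close> and \<open>m\<close> at \<open>gen F k\<close>, so both end values survive
  the addition.\<close>

lemma separating_form_add:
  assumes "separating_form F i j m" "separating_form F j k m'"
    and "i \<in> {1..num_rays F}" "k \<in> {1..num_rays F}" "i \<noteq> j" "j \<noteq> k" "i \<noteq> k"
  shows "separating_form F i k (\<lambda>x. m x + m' x)"
  unfolding separating_form_def
proof (intro conjI ballI)
  show "(\<lambda>x. m x + m' x) \<in> dual_lattice"
    using assms(1,2) by (simp add: separating_form_def dual_lattice_add)
  show "m (gen F i) + m' (gen F i) = 1" "m (gen F k) + m' (gen F k) = - 1"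
    using assms by (auto simp: separating_form_def)
  fix r assume "r \<in> {1..num_rays F} - {i, k}"
  then show "m (gen F r) + m' (gen F r) = 0"
    using assms by (cases "r = j") (auto simp: separating_form_def)
qed

text \<open>This removes the binomials from the problem: what remains is a condition on weights and
  integral forms, which can be added.\<close>

lemma pair_mem_Gly_iff:
  assumes F: "tropical_fan F"
    and ij: "i \<in> {1..num_rays F}" "j \<in> {1..num_rays F}" "i \<noteq> j"
  shows "{ray (gen F i), ray (gen F j)} \<in> Gly F \<longleftrightarrow>
    weight F i = 1 \<and> weight F j = 1 \<and> (\<exists>m. separating_form F i j m)"
proof
  have split: "(\<Sum>k=1..num_rays F. f k) = f i + f j + (\<Sum>k\<in>{1..num_rays F} - {i, j}. f k)"
    for f :: "nat \<Rightarrow> real"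
    using ij sum.subset_diff[of "{i, j}" "{1..num_rays F}" f] by simp
  {
    assume "{ray (gen F i), ray (gen F j)} \<in> Gly F"
    then obtain l h where lh: "l \<in> dual_lattice" "h \<in> dual_lattice"
      and num: "intersection_number (\<lambda>x. max (l x) (h x)) F = 1"
      and gal: "gallery F (\<lambda>x. max (l x) (h x)) = {ray (gen F i), ray (gen F j)}"
      by (auto simp: Gly_def tropical_binomial_def)
    define m where "m = (\<lambda>x. h x - l x)"
    have lin: "linear l" "linear h"
      using lh by (auto simp: dual_lattice_def)
    have m: "m \<in> dual_lattice" "linear m"
      using dual_lattice_diff[OF lh(2,1)] by (auto simp: m_def dual_lattice_def)
    have abs1: "\<bar>m (gen F i)\<bar> = 1" "\<bar>m (gen F j)\<bar> = 1"
      using ij gal ray_mem_gallery_max_iff[OF F lin] by (auto simp: m_def)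
    have pos: "real (weight F k) \<ge> 1" if "k \<in> {1..num_rays F}" for k
      using F that by (auto simp: tropical_fan_def Suc_le_eq)
    define rest where "rest = (\<Sum>k\<in>{1..num_rays F} - {i, j}. real (weight F k) * \<bar>m (gen F k)\<bar>)"
    have "real (weight F i) + real (weight F j) + rest = 2"
      using num split[of "\<lambda>k. real (weight F k) * \<bar>m (gen F k)\<bar>"] abs1
        intersection_number_max[OF F lin] by (simp add: m_def rest_def)
    moreover have "rest \<ge> 0"
      by (simp add: rest_def sum_nonneg)
    \<comment> \<open>The two gallery rays already contribute at least 1 each to a total of 2, so
      every inequality is an equality.\<close>
    ultimately have w: "real (weight F i) = 1" "real (weight F j) = 1" and "rest = 0"
      using pos[OF ij(1)] pos[OF ij(2)] by linarith+
    then have "\<forall>k\<in>{1..num_rays F} - {i, j}. real (weight F k) * \<bar>m (gen F k)\<bar> = 0"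
      unfolding rest_def by (subst (asm) sum_nonneg_eq_0_iff) auto
    then have zero: "\<forall>k\<in>{1..num_rays F} - {i, j}. m (gen F k) = 0"
      using pos by (metis DiffD1 abs_eq_0 mult_eq_0_iff not_one_le_zero)
    \<comment> \<open>Balancing excludes equal signs at the two rays: with unit weights and zeros
      elsewhere only these two terms remain.\<close>
    have "m (gen F i) + m (gen F j) = 0"
      using balanced_linear[OF F m(2)] split[of "\<lambda>k. real (weight F k) * m (gen F k)"] zero w
      by simp
    then consider "m (gen F i) = 1" "m (gen F j) = -1" | "m (gen F j) = 1" "m (gen F i) = -1"
      using abs1 by linarith
    then have "\<exists>m. separating_form F i j m"
    proof cases
      case 1
      then have "separating_form F i j m"
        using m(1) zero by (simp add: separating_form_def)
      then show ?thesis by blast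
    next
      case 2
      then have "separating_form F j i m"
        using m(1) zero by (auto simp: separating_form_def)
      then show ?thesis
        by (blast dest: separating_form_swap)
    qed
    then show "weight F i = 1 \<and> weight F j = 1 \<and> (\<exists>m. separating_form F i j m)"
      using w by simp
  }
  {
    assume "weight F i = 1 \<and> weight F j = 1 \<and> (\<exists>m. separating_form F i j m)"
    then obtain m where w: "weight F i = 1" "weight F j = 1" and sep: "separating_form F i j m"
      by blast
    \<comment> \<open>With \<open>l = 0\<close> and \<open>h = m\<close> the difference
      \<open>h - l\<close> is \<open>m\<close> itself, and the intersection number is (1 + 1) / 2 =
      1.\<close>
    let ?L = "\<lambda>x. max 0 (m x)"
    have m: "m \<in> dual_lattice" "linear m"
      using sep by (auto simp: separating_form_def dual_lattice_def)
    have "intersection_number ?L F = 1"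
      using intersection_number_max[OF F linear_zero m(2)] sep w
        split[of "\<lambda>k. real (weight F k) * \<bar>m (gen F k)\<bar>"]
      by (simp add: separating_form_def)
    moreover have "tropical_binomial ?L"
      using dual_lattice_zero m(1) by (auto simp: tropical_binomial_def)
    moreover have "gallery F ?L = {ray (gen F i), ray (gen F j)}"
    proof -
      have mem: "ray (gen F k) \<in> gallery F ?L \<longleftrightarrow> k \<in> {i, j}"
        if "k \<in> {1..num_rays F}" for k
        using that sep ray_mem_gallery_max_iff[OF F linear_zero m(2) that]
        by (cases "k \<in> {i, j}") (auto simp: separating_form_def)
      have "a \<in> {ray (gen F i), ray (gen F j)}" if "a \<in> gallery F ?L" for a
      proof -
        obtain k where "k \<in> {1..num_rays F}" "a = ray (gen F k)"
          using \<open>a \<in> gallery F ?L\<close> unfolding gallery_def by blast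
        then show ?thesis
          using mem[of k] that by blast
      qed
      then show ?thesis
        using mem[OF ij(1)] mem[OF ij(2)] by blast
    qed
    ultimately show "{ray (gen F i), ray (gen F j)} \<in> Gly F"
      unfolding Gly_def by (intro CollectI exI[of _ ?L]) simp
  }
qed

theorem theorem3p2:
  fixes F :: "('n::finite) fan_data"
  assumes "tropical_fan F"
    and "span (\<Union> (rays F)) = UNIV"
  shows "equiv (rays F) (gallery_rel F)"
proof (rule equivI)
  note F = assms(1)
  show "gallery_rel F \<subseteq> rays F \<times> rays F"
    by (auto simp: gallery_rel_def rays_def)
  show "refl_on (rays F) (gallery_rel F)"
    unfolding gallery_rel_def rays_def refl_on_def by blast
  show "sym (gallery_rel F)"
  proof (rule symI)
    fix a b assume "(a, b) \<in> gallery_rel F"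
    then obtain i j where "i \<in> {1..num_rays F}" "j \<in> {1..num_rays F}"
      "a = ray (gen F i)" "b = ray (gen F j)" "i = j \<or> {b, a} \<in> Gly F"
      by (auto simp: gallery_rel_def insert_commute)
    then show "(b, a) \<in> gallery_rel F"
      unfolding gallery_rel_def by blast
  qed
  show "trans (gallery_rel F)"
  proof (rule transI)
    fix a b c assume ab: "(a, b) \<in> gallery_rel F" and bc: "(b, c) \<in> gallery_rel F"
    show "(a, c) \<in> gallery_rel F"
    \<comment> \<open>If two of the rays coincide, the claim is one of the given relations or
      reflexivity. Otherwise the indices are pairwise distinct, as adding forms requires.\<close>
    proof (cases "a = b \<or> b = c \<or> a = c")
      case True
      then show ?thesis
        using ab bc by (auto simp: gallery_rel_def)
    next
      case False
      obtain i j where ij: "i \<in> {1..num_rays F}" "j \<in> {1..num_rays F}"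
        "a = ray (gen F i)" "b = ray (gen F j)" "{a, b} \<in> Gly F"
        using ab False by (auto simp: gallery_rel_def)
      obtain k where k: "k \<in> {1..num_rays F}" "c = ray (gen F k)" and bc': "{b, c} \<in> Gly F"
        using bc False by (auto simp: gallery_rel_def)
      have ne: "i \<noteq> j" "j \<noteq> k" "i \<noteq> k"
        using False ij k by auto
      \<comment> \<open>The first pair gives weight 1 at \<open>i\<close> and the second at
        \<open>k\<close>, which is the weight condition for the pair \<open>(i, k)\<close>.\<close>
      obtain m m' where "separating_form F i j m" "separating_form F j k m'"
        and w: "weight F i = 1" "weight F k = 1"
        using ij k bc' ne pair_mem_Gly_iff[OF F, of i j] pair_mem_Gly_iff[OF F, of j k] by auto
      then have "separating_form F i k (\<lambda>x. m x + m' x)"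
        using separating_form_add ij k ne by blast
      then have "{a, c} \<in> Gly F"
        using pair_mem_Gly_iff[OF F, of i k] ij k ne w by auto
      then show ?thesis
        using ij k by (auto simp: gallery_rel_def)
    qed
  qed
qed

end
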